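(* Let $R>0$. There exists an $H^2$-neighbourhood $\mathcal U$ of $0$ in $H^2(\mathbb T,\mathbb R^3)$ such that, for every $(\lambda,\mathbf u)\in(0,+\infty)\times\mathcal U$, one has $$\widehat{\mathcal G}(\lambda,\mathbf u)=0\quad\Longleftrightarrow\quad\mathcal G(\lambda,\mathbf u)=0.$$
   Context: Fix $R>0$; $\mathbb T=\mathbb R/2\pi\mathbb Z$, $\mathbf x_0(\eta)=(R\cos\eta,R\sin\eta,0)$, $E_2(\eta)=(-\sin\eta,\cos\eta,0)$, $E_3=e_3=(0,0,1)$. For $\lambda>0$, $\mathbf u\in H^2(\mathbb T,\mathbb R^3)$: $\mathcal F(\lambda,\mathbf u)=\mathbf x_0\times\mathbf u''+\mathbf u\times\mathbf x_0''+\mathbf u\times\mathbf u''-\lambda e_3\times\mathbf u+\lambda\mathbf u'\in L^2(\mathbb T,\mathbb R^3)$; $\mathcal C(\mathbf u)=\mathbf x_0\cdot\mathbf u+\frac12\|\mathbf u\|^2\in H^2(\mathbb T)$ (pointwise); $\mathcal G(\lambda,\mathbf u)=(\mathcal F(\lambda,\mathbf u),\mathcal C(\mathbf u))$; and the tangential augmented operator is $\widehat{\mathcal G}(\lambda,\mathbf u)=\big(\mathcal F(\lambda,\mathbf u)\cdot E_2,\ \mathcal F(\lambda,\mathbf u)\cdot E_3,\ \mathcal C(\mathbf u)\big)\in L^2(\mathbb T)\times L^2(\mathbb T)\times H^2(\mathbb T)$. *)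

theory Defs
  imports "HOL-Analysis.Analysis"
begin

text \<open>
  Functions on the torus \<open>\<real>/2\<pi>\<int>\<close> are represented by \<open>2\<pi>\<close>-periodic functions on the real line.
  Elements of \<open>L\<^sup>2\<close> and \<open>H\<^sup>2\<close> are represented by arbitrary periodic Lebesgue measurable functions,
  no particular representative being chosen; accordingly, equality in these spaces is equality
  almost everywhere.
\<close>

definition torus_periodic :: "(real \<Rightarrow> 'a) \<Rightarrow> bool" where
  "torus_periodic f \<longleftrightarrow> (\<forall>t. f (t + 2 * pi) = f t)"

definition L2_torus :: "(real \<Rightarrow> 'a::euclidean_space) set" where
  "L2_torus = {f. torus_periodic f \<and> f \<in> borel_measurable lebesgue \<and>
     set_integrable lebesgue {0..2 * pi} (\<lambda>t. (norm (f t))\<^sup>2)}"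

definition torus_test_function :: "(real \<Rightarrow> real) \<Rightarrow> bool" where
  "torus_test_function \<phi> \<longleftrightarrow>
     torus_periodic \<phi> \<and> (\<forall>n t. (deriv ^^ n) \<phi> field_differentiable at t)"

definition has_weak_deriv ::
    "(real \<Rightarrow> 'a::euclidean_space) \<Rightarrow> (real \<Rightarrow> 'a) \<Rightarrow> bool" where
  "has_weak_deriv f g \<longleftrightarrow> f \<in> L2_torus \<and> g \<in> L2_torus \<and>
     (\<forall>\<phi>. torus_test_function \<phi> \<longrightarrow>
        (LINT t:{0..2 * pi}|lebesgue. deriv \<phi> t *\<^sub>R f t) =
        - (LINT t:{0..2 * pi}|lebesgue. \<phi> t *\<^sub>R g t))"

text \<open>Weak derivatives are unique only almost everywhere; \<open>weak_deriv\<close> picks some representative.\<close>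

definition weak_deriv :: "(real \<Rightarrow> 'a::euclidean_space) \<Rightarrow> real \<Rightarrow> 'a" where
  "weak_deriv f = (SOME g. has_weak_deriv f g)"

definition H2_torus :: "(real \<Rightarrow> 'a::euclidean_space) set" where
  "H2_torus = {f. \<exists>g h. has_weak_deriv f g \<and> has_weak_deriv g h}"

definition H2_norm :: "(real \<Rightarrow> 'a::euclidean_space) \<Rightarrow> real" where
  "H2_norm f = sqrt
     ((LINT t:{0..2 * pi}|lebesgue. (norm (f t))\<^sup>2) +
      (LINT t:{0..2 * pi}|lebesgue. (norm (weak_deriv f t))\<^sup>2) +
      (LINT t:{0..2 * pi}|lebesgue. (norm (weak_deriv (weak_deriv f) t))\<^sup>2))"

definition H2_nhd_zero :: "(real \<Rightarrow> 'a::euclidean_space) set \<Rightarrow> bool" where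
  "H2_nhd_zero U \<longleftrightarrow> U \<subseteq> H2_torus \<and> (\<exists>\<delta>>0. {f \<in> H2_torus. H2_norm f < \<delta>} \<subseteq> U)"

text \<open>Being the zero element of \<open>L\<^sup>2\<close> or of \<open>H\<^sup>2\<close>.\<close>

definition ae_zero :: "(real \<Rightarrow> 'a::euclidean_space) \<Rightarrow> bool" where
  "ae_zero f \<longleftrightarrow> (AE t in lebesgue. f t = 0)"

definition x0 :: "real \<Rightarrow> real \<Rightarrow> real^3" where
  "x0 R \<eta> = vector [R * cos \<eta>, R * sin \<eta>, 0]"

definition x0'' :: "real \<Rightarrow> real \<Rightarrow> real^3" where
  "x0'' R \<eta> = vector_derivative (\<lambda>s. vector_derivative (x0 R) (at s)) (at \<eta>)"

definition E2 :: "real \<Rightarrow> real^3" where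
  "E2 \<eta> = vector [- sin \<eta>, cos \<eta>, 0]"

definition E3 :: "real^3" where
  "E3 = vector [0, 0, 1]"

definition F_op :: "real \<Rightarrow> real \<Rightarrow> (real \<Rightarrow> real^3) \<Rightarrow> real \<Rightarrow> real^3" where
  "F_op R lam u \<eta> =
     cross3 (x0 R \<eta>) (weak_deriv (weak_deriv u) \<eta>)
     + cross3 (u \<eta>) (x0'' R \<eta>)
     + cross3 (u \<eta>) (weak_deriv (weak_deriv u) \<eta>)
     - lam *\<^sub>R cross3 E3 (u \<eta>)
     + lam *\<^sub>R weak_deriv u \<eta>"

definition C_op :: "real \<Rightarrow> (real \<Rightarrow> real^3) \<Rightarrow> real \<Rightarrow> real" where
  "C_op R u \<eta> = x0 R \<eta> \<bullet> u \<eta> + 1 / 2 * (norm (u \<eta>))\<^sup>2"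

definition G_op :: "real \<Rightarrow> real \<Rightarrow> (real \<Rightarrow> real^3) \<Rightarrow> (real \<Rightarrow> real^3) \<times> (real \<Rightarrow> real)" where
  "G_op R lam u = (F_op R lam u, C_op R u)"

definition G_hat ::
    "real \<Rightarrow> real \<Rightarrow> (real \<Rightarrow> real^3) \<Rightarrow> (real \<Rightarrow> real) \<times> (real \<Rightarrow> real) \<times> (real \<Rightarrow> real)" where
  "G_hat R lam u = (\<lambda>\<eta>. F_op R lam u \<eta> \<bullet> E2 \<eta>, \<lambda>\<eta>. F_op R lam u \<eta> \<bullet> E3, C_op R u)"

text \<open>Vanishing in \<open>L\<^sup>2 \<times> H\<^sup>2\<close> and in \<open>L\<^sup>2 \<times> L\<^sup>2 \<times> H\<^sup>2\<close>.\<close>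

definition pair_zero ::
    "(real \<Rightarrow> 'a::euclidean_space) \<times> (real \<Rightarrow> 'b::euclidean_space) \<Rightarrow> bool" where
  "pair_zero = (\<lambda>(f, g). ae_zero f \<and> ae_zero g)"

definition triple_zero ::
    "(real \<Rightarrow> 'a::euclidean_space) \<times> (real \<Rightarrow> 'b::euclidean_space) \<times>
     (real \<Rightarrow> 'c::euclidean_space) \<Rightarrow> bool" where
  "triple_zero = (\<lambda>(f, g, h). ae_zero f \<and> ae_zero g \<and> ae_zero h)"

end

(*
  Write x = x0 + u. Since x0 and its second derivative are parallel, F = x \<times> x'' - \<lambda> e3 \<times> x + \<lambda> x',
  whence F \<bullet> x = \<lambda> (|x|^2 / 2)' = \<lambda> C'. If C vanishes, F is orthogonal to x, to E2 and to E3; it is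
  then a multiple f E1 of the radial vector with f (R + u \<bullet> E1) = 0, and f = 0 as soon as |u| < R,
  which a small H^2 norm guarantees. To differentiate C and to bound |u|, u is replaced by a C^1
  representative: a weak derivative, tested on trigonometric polynomials only, determines the
  function up to a constant, by Stone-Weierstrass on the unit circle.
*)
theory Submission imports Defs
begin

subsection \<open>Trigonometric polynomials\<close>


text \<open>The obstacle is that an element of H^2 is an arbitrary measurable representative and
  \<open>weak_deriv\<close> a mere choice: neither \<open>u\<close> nor C(u) need be differentiable
  at any point. The derivative of C is therefore spelled out as x0' . u + x0 . u' + u . u', and this
  expression is shown to vanish almost everywhere by computing with the representative and
  transferring the result back. Trigonometric test functions suffice because all their iterated
  derivatives are explicit and because an integrable function whose Fourier coefficients all vanish
  is zero almost everywhere. The density argument lives on the circle instead of [0, 2 pi] since the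
  approximants have to be periodic. In F . x the parameter \<lambda> is only a factor of C', so the
  size of the neighbourhood depends on R alone. Radius R/6 makes the oscillation of \<open>u\<close>
  over a period at most R/2, while the L^2 norm is too small for |u| to stay above R/2 throughout;
  hence |u| < R. The analysis takes place on one period, and periodicity carries the conclusions to
  the whole line.\<close>

inductive trig_polynomial :: "(real \<Rightarrow> real) \<Rightarrow> bool" where
  cos: "trig_polynomial (\<lambda>t. cos (of_int k * t))"
| sin: "trig_polynomial (\<lambda>t. sin (of_int k * t))"
| add: "trig_polynomial p \<Longrightarrow> trig_polynomial q \<Longrightarrow> trig_polynomial (\<lambda>t. p t + q t)"
| scale: "trig_polynomial p \<Longrightarrow> trig_polynomial (\<lambda>t. c * p t)"

lemma trig_polynomial_const: "trig_polynomial (\<lambda>t. c)"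
  using trig_polynomial.scale [OF trig_polynomial.cos [of 0], of c] by simp

text \<open>Product-to-sum formulas. Frequencies range over all integers, so the difference j - k
  needs no case distinction.\<close>

lemma trig_polynomial_mult_cos:
  "trig_polynomial p \<Longrightarrow> trig_polynomial (\<lambda>t. p t * cos (of_int k * t))"
proof (induction rule: trig_polynomial.induct)
  case (cos j)
  have "(\<lambda>t::real. cos (of_int j * t) * cos (of_int k * t)) =
      (\<lambda>t. (1/2) * (cos (of_int (j - k) * t) + cos (of_int (j + k) * t)))"
    by (simp add: fun_eq_iff sin_add sin_diff cos_add cos_diff distrib_right left_diff_distrib)
  then show ?case
    by (simp only:) (intro trig_polynomial.intros)
next
  case (sin j)
  have "(\<lambda>t::real. sin (of_int j * t) * cos (of_int k * t)) =
      (\<lambda>t. (1/2) * (sin (of_int (j + k) * t) + sin (of_int (j - k) * t)))"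
    by (simp add: fun_eq_iff sin_add sin_diff cos_add cos_diff distrib_right left_diff_distrib)
  then show ?case
    by (simp only:) (intro trig_polynomial.intros)
next
  case (add p q)
  then show ?case
    using trig_polynomial.add by (simp add: distrib_right)
next
  case (scale p c)
  then show ?case
    using trig_polynomial.scale by (simp add: mult.assoc)
qed

lemma trig_polynomial_mult_sin:
  "trig_polynomial p \<Longrightarrow> trig_polynomial (\<lambda>t. p t * sin (of_int k * t))"
proof (induction rule: trig_polynomial.induct)
  case (cos j)
  \<comment> \<open>The difference is written as a sum with a term scaled by -1, which is the shape
    that the introduction rules produce.\<close>
  have "(\<lambda>t::real. cos (of_int j * t) * sin (of_int k * t)) =
      (\<lambda>t. (1/2) * (sin (of_int (j + k) * t) + (-1) * sin (of_int (j - k) * t)))"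
    by (simp add: fun_eq_iff sin_add sin_diff cos_add cos_diff distrib_right left_diff_distrib)
  then show ?case
    by (simp only:) (intro trig_polynomial.intros)
next
  case (sin j)
  have "(\<lambda>t::real. sin (of_int j * t) * sin (of_int k * t)) =
      (\<lambda>t. (1/2) * (cos (of_int (j - k) * t) + (-1) * cos (of_int (j + k) * t)))"
    by (simp add: fun_eq_iff sin_add sin_diff cos_add cos_diff distrib_right left_diff_distrib)
  then show ?case
    by (simp only:) (intro trig_polynomial.intros)
next
  case (add p q)
  then show ?case
    using trig_polynomial.add by (simp add: distrib_right)
next
  case (scale p c)
  then show ?case
    using trig_polynomial.scale by (simp add: mult.assoc)
qed

lemma trig_polynomial_mult:
  assumes "trig_polynomial p" "trig_polynomial q"
  shows "trig_polynomial (\<lambda>t. p t * q t)"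
  using assms(2)
proof (induction rule: trig_polynomial.induct)
  case (add q r)
  then show ?case
    using trig_polynomial.add by (simp add: distrib_left)
next
  case (scale q c)
  then show ?case
    using trig_polynomial.scale [OF scale.IH, of c] by (simp add: algebra_simps)
qed (use assms(1) in \<open>simp_all add: trig_polynomial_mult_cos trig_polynomial_mult_sin\<close>)

text \<open>Real polynomial functions on the plane are generated by constants and linear forms, and
  a linear form restricted to the circle is f(1) cos t + f(i) sin t.\<close>

lemma trig_polynomial_compose_cis:
  "real_polynomial_function g \<Longrightarrow> trig_polynomial (\<lambda>t. g (cis t))"
proof (induction rule: real_polynomial_function.induct)
  case (linear f)
  interpret bounded_linear f by fact
  have "f (cis t) = f 1 * cos (of_int 1 * t) + f \<i> * sin (of_int 1 * t)" for t
  proof -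
    have "cis t = cos t *\<^sub>R 1 + sin t *\<^sub>R \<i>"
      by (simp add: complex_eq_iff)
    then show ?thesis
      by (simp add: add scaleR)
  qed
  then show ?case
    by (simp only:) (intro trig_polynomial.intros)
qed (simp_all add: trig_polynomial_const trig_polynomial.add trig_polynomial_mult)

text \<open>Stone-Weierstrass on the compact circle. The bound holds for every real t because
  \<open>cis t\<close> never leaves the circle.\<close>

lemma trig_polynomial_approximation:
  fixes f :: "complex \<Rightarrow> real"
  assumes "continuous_on (sphere 0 1) f" "e > 0"
  obtains p where "trig_polynomial p" "\<And>t. \<bar>f (cis t) - p t\<bar> < e"
proof -
  obtain g where g: "real_polynomial_function g" "\<And>z. z \<in> sphere 0 1 \<Longrightarrow> \<bar>f z - g z\<bar> < e"
    using Stone_Weierstrass_real_polynomial_function [OF compact_sphere assms] by blast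
  show ?thesis
    using that [OF trig_polynomial_compose_cis [OF g(1)]] g(2) by simp
qed

lemma continuous_on_trig_polynomial: "trig_polynomial p \<Longrightarrow> continuous_on A p"
  by (induction rule: trig_polynomial.induct) (auto intro!: continuous_intros)

subsection \<open>Functions with vanishing Fourier coefficients\<close>


abbreviation circ :: "real measure" where
  "circ \<equiv> lebesgue_on {0..2 * pi}"

lemma integrable_circ_continuous_scaleR:
  fixes w :: "real \<Rightarrow> 'a::euclidean_space"
  assumes "continuous_on {0..2 * pi} p" "integrable circ w"
  shows "integrable circ (\<lambda>t. p t *\<^sub>R w t)"
proof -
  have "bounded (p ` {0..2 * pi})"
    using assms(1) by (intro compact_imp_bounded compact_continuous_image) auto
  then obtain B where B: "\<And>t. t \<in> {0..2 * pi} \<Longrightarrow> \<bar>p t\<bar> \<le> B"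
    unfolding bounded_iff by (metis imageI real_norm_def)
  have "p \<in> borel_measurable circ"
    using assms(1) by (intro continuous_imp_measurable_on_sets_lebesgue) auto
  then show ?thesis
    using assms(2)
  proof (intro Bochner_Integration.integrable_bound [OF integrable_scaleR_right [of B, OF integrable_norm [OF assms(2)]]])
    show "AE t in circ. norm (p t *\<^sub>R w t) \<le> norm (B *\<^sub>R norm (w t))"
      by (intro AE_I2) (auto intro!: mult_right_mono order_trans [OF B] simp: abs_mult)
  qed auto
qed

lemma integrable_circ_continuous:
  fixes p :: "real \<Rightarrow> real"
  assumes "continuous_on {0..2 * pi} p"
  shows "integrable circ p"
  using integrable_circ_continuous_scaleR [OF assms, of "\<lambda>_. 1 :: real"] by simp

lemma trig_polynomial_orthogonal:
  fixes w :: "real \<Rightarrow> real"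
  assumes w: "integrable circ w"
    and c: "\<And>k::int. (LINT t|circ. cos (k * t) * w t) = 0"
    and s: "\<And>k::int. (LINT t|circ. sin (k * t) * w t) = 0"
    and p: "trig_polynomial p"
  shows "(LINT t|circ. p t * w t) = 0"
  using p
proof (induction rule: trig_polynomial.induct)
  case (add p q)
  have "integrable circ (\<lambda>t. p t * w t)" "integrable circ (\<lambda>t. q t * w t)"
    using integrable_circ_continuous_scaleR [OF continuous_on_trig_polynomial w] add.hyps by auto
  then show ?case
    using add.IH by (simp add: distrib_right)
qed (use c s in \<open>simp_all add: mult.assoc\<close>)

lemma circle_orthogonal:
  fixes w :: "real \<Rightarrow> real" and f :: "complex \<Rightarrow> real"
  assumes w: "integrable circ w"
    and c: "\<And>k::int. (LINT t|circ. cos (k * t) * w t) = 0"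
    and s: "\<And>k::int. (LINT t|circ. sin (k * t) * w t) = 0"
    and f: "continuous_on (sphere 0 1) f"
  shows "(LINT t|circ. f (cis t) * w t) = 0"
proof (rule ccontr)
  define I where "I = (LINT t|circ. \<bar>w t\<bar>)"
  assume "(LINT t|circ. f (cis t) * w t) \<noteq> 0" (is "?J \<noteq> 0")
  have I: "I \<ge> 0"
    unfolding I_def by simp
  \<comment> \<open>Replacing f by p changes the integral by at most e I, and this choice makes e I
    < |J|. The summand 1 keeps the denominator positive when I = 0.\<close>
  define e where "e = \<bar>?J\<bar> / (2 * (I + 1))"
  have e: "e > 0"
    using \<open>?J \<noteq> 0\<close> I by (simp add: e_def)
  obtain p where p: "trig_polynomial p" "\<And>t. \<bar>f (cis t) - p t\<bar> < e"
    using trig_polynomial_approximation [OF f e] by blast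
  have fc: "continuous_on {0..2 * pi} (\<lambda>t. f (cis t))"
    by (rule continuous_on_compose2 [OF f]) (auto intro!: continuous_intros simp: cis_conv_exp)
  have if': "integrable circ (\<lambda>t. f (cis t) * w t)"
    using integrable_circ_continuous_scaleR [OF fc w] by simp
  have ip: "integrable circ (\<lambda>t. p t * w t)"
    using integrable_circ_continuous_scaleR [OF continuous_on_trig_polynomial w] p by simp
  have "?J = (LINT t|circ. (f (cis t) - p t) * w t)"
    using if' ip trig_polynomial_orthogonal [OF w c s p(1)] by (simp add: left_diff_distrib)
  also have "\<bar>\<dots>\<bar> \<le> (LINT t|circ. e * \<bar>w t\<bar>)"
  proof -
    have "\<bar>LINT t|circ. (f (cis t) - p t) * w t\<bar> \<le> (LINT t|circ. \<bar>(f (cis t) - p t) * w t\<bar>)"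
      by (rule integral_abs_bound)
    also have "\<dots> \<le> (LINT t|circ. e * \<bar>w t\<bar>)"
    proof (rule integral_mono)
      show "integrable circ (\<lambda>t. \<bar>(f (cis t) - p t) * w t\<bar>)"
        using Bochner_Integration.integrable_diff [OF if' ip] by (simp add: left_diff_distrib)
      show "\<bar>(f (cis t) - p t) * w t\<bar> \<le> e * \<bar>w t\<bar>" for t
        using p(2) [of t] by (simp add: abs_mult mult_right_mono)
    qed (use w in simp)
    finally show ?thesis .
  qed
  also have "\<dots> = e * I"
    by (simp add: I_def)
  also have "\<dots> < \<bar>?J\<bar>"
    using I \<open>?J \<noteq> 0\<close> unfolding e_def by (simp add: field_simps) (smt (verit) mult_nonneg_nonneg zero_less_abs_iff)
  finally show False
    by simp
qed

lemma cis_eq_cis_imp_eq: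
  assumes "cis s = cis t" "\<bar>s - t\<bar> < 2 * pi"
  shows "s = t"
proof -
  have "cis (s - t) = 1"
    using assms(1) by (simp flip: cis_divide)
  then have "cos (s - t) = 1"
    by (metis cis.sel(1) one_complex.sel(1))
  then obtain n :: int where n: "s - t = of_int n * 2 * pi"
    using cos_one_2pi_int by auto
  then have "\<bar>real_of_int n\<bar> < 1"
    using assms(2) by (simp add: abs_mult)
  then have "n = 0"
    by linarith
  then show ?thesis
    using n by simp
qed

text \<open>The endpoints 0 and 2 pi are the only two points of the period that \<open>cis\<close>
  identifies; discarding them lets subsets of the period be recognised by their images on the
  circle.\<close>

lemma AE_circ_interior: "AE t in circ. 0 < t \<and> t < 2 * pi"
proof -
  have "{0, 2 * pi} \<in> null_sets lebesgue"
    by (auto intro!: null_sets_completionI finite_imp_null_set_lborel)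
  then have "AE t in lebesgue. t \<notin> {0, 2 * pi}"
    by (rule AE_not_in)
  then have "AE t in lebesgue. t \<in> {0..2 * pi} \<longrightarrow> 0 < t \<and> t < 2 * pi"
    by eventually_elim auto
  then show ?thesis
    by (subst AE_restrict_space_iff) (simp_all del: AE_conj_iff imp_conjR)
qed

text \<open>The cut-offs \<open>max 0 (1 - n dist(\<cdot>, cis ` K))\<close> decrease to the indicator function of \<open>cis ` K\<close>.\<close>

lemma closed_set_integral_zero:
  fixes w :: "real \<Rightarrow> real"
  assumes w: "integrable circ w"
    and c: "\<And>k::int. (LINT t|circ. cos (k * t) * w t) = 0"
    and s: "\<And>k::int. (LINT t|circ. sin (k * t) * w t) = 0"
    and K: "closed K" "K \<subseteq> {0..2 * pi}"
  shows "(LINT t:K|circ. w t) = 0"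
proof (cases "K = {}")
  case False
  define C where "C = cis ` K"
  have "compact K"
    using K by (meson bounded_closed_interval bounded_subset compact_eq_bounded_closed)
  then have "compact C"
    unfolding C_def by (intro compact_continuous_image) (auto intro!: continuous_intros simp: cis_conv_exp)
  then have C: "closed C" "C \<noteq> {}"
    using False by (auto simp: C_def compact_imp_closed)
  define f where "f n z = max 0 (1 - real n * infdist z C)" for n z
  have f: "continuous_on A (f n)" for n A
    unfolding f_def by (intro continuous_intros)
  have f01: "0 \<le> f n z" "f n z \<le> 1" for n z
    using infdist_nonneg [of z C] by (auto simp: f_def)
  have lim: "(\<lambda>n. f n z) \<longlonglongrightarrow> indicator C z" for z
  proof (cases "z \<in> C")
    case True
    then show ?thesis
      by (simp add: f_def)
  next
    case False
    then have "infdist z C > 0"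
      using C infdist_pos_not_in_closed by blast
    then obtain N where N: "real N * infdist z C > 1"
      by (metis reals_Archimedean3)
    have "f n z = 0" if "n \<ge> N" for n
    proof -
      have "real N * infdist z C \<le> real n * infdist z C"
        using that by (intro mult_right_mono) (auto simp: infdist_nonneg)
      then show ?thesis
        using N by (simp add: f_def)
    qed
    then have "\<forall>\<^sub>F n in sequentially. f n z = indicator C z"
      using False by (auto simp: eventually_sequentially)
    then show ?thesis
      by (rule tendsto_eventually)
  qed
  have meas: "(\<lambda>t. f n (cis t)) \<in> borel_measurable circ" for n
    by (intro continuous_imp_measurable_on_sets_lebesgue continuous_on_compose2 [OF f])
      (auto intro!: continuous_intros simp: cis_conv_exp)
  have Kc: "K \<in> sets circ"
    using K by (auto simp: sets_restrict_space_iff)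
  have "(\<lambda>n. LINT t|circ. f n (cis t) * w t) \<longlonglongrightarrow> (LINT t|circ. indicator K t * w t)"
  proof (rule integral_dominated_convergence)
    show "(\<lambda>t. indicator K t * w t) \<in> borel_measurable circ"
      using Kc w by measurable
    show "(\<lambda>t. f n (cis t) * w t) \<in> borel_measurable circ" for n
      using meas w by measurable
    show "integrable circ (\<lambda>t. \<bar>w t\<bar>)"
      using w by simp
    show "AE t in circ. norm (f n (cis t) * w t) \<le> \<bar>w t\<bar>" for n
      using f01 by (intro AE_I2) (simp add: abs_mult mult_left_le_one_le)
    show "AE t in circ. (\<lambda>n. f n (cis t) * w t) \<longlonglongrightarrow> indicator K t * w t"
      using AE_circ_interior
    proof eventually_elim
      case (elim t)
      \<comment> \<open>Here t is strictly inside the period, so its distance to any point of K is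
        less than 2 pi and \<open>cis\<close> separates the two. An endpoint outside K could fail
        this when the other endpoint lies in K.\<close>
      have "cis t \<in> C \<longleftrightarrow> t \<in> K"
      proof
        assume "cis t \<in> C"
        then obtain u where u: "u \<in> K" "cis t = cis u"
          by (auto simp: C_def)
        with K(2) elim have "t = u"
          by (intro cis_eq_cis_imp_eq) (auto simp: abs_less_iff subset_iff)
        with u show "t \<in> K"
          by simp
      qed (auto simp: C_def)
      then have "indicator C (cis t) = (indicator K t :: real)"
        by (simp add: indicator_def)
      then show ?case
        using tendsto_mult_right [OF lim [of "cis t"], of "w t"] by simp
    qed
  qed
  moreover have "(LINT t|circ. f n (cis t) * w t) = 0" for n
    by (rule circle_orthogonal [OF w c s f])
  ultimately show ?thesis
    by (simp add: set_lebesgue_integral_def LIMSEQ_const_iff)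
qed (simp add: set_lebesgue_integral_def)

text \<open>Inner regularity: up to a null set, {w > 0} is a countable union of compact sets. On
  each of them w is positive with integral zero, so each is null.\<close>

lemma AE_nonpos_if_fourier_zero:
  fixes w :: "real \<Rightarrow> real"
  assumes w: "integrable circ w"
    and c: "\<And>k::int. (LINT t|circ. cos (k * t) * w t) = 0"
    and s: "\<And>k::int. (LINT t|circ. sin (k * t) * w t) = 0"
  shows "AE t in circ. w t \<le> 0"
proof -
  define P where "P = {t \<in> space circ. w t > 0}"
  have "P \<in> sets circ"
    unfolding P_def using w by measurable
  then have P: "P \<in> sets lebesgue" "P \<subseteq> {0..2 * pi}"
    by (auto simp: sets_restrict_space_iff)
  obtain C T where C: "fsigma C" "T \<in> null_sets lebesgue" "C \<union> T = P"
    using lebesgue_set_almost_fsigma [OF P(1)] by metis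
  obtain K :: "nat \<Rightarrow> real set" where K: "range K \<subseteq> Collect compact" "C = \<Union> (range K)"
    using fsigma_Union_compact C(1) by metis
  have "K n \<in> null_sets circ" for n
  proof -
    have Kn: "K n \<subseteq> P" "closed (K n)"
      using K C(3) by (auto intro: compact_imp_closed)
    have "(LINT t:K n|circ. w t) = 0"
      using Kn P by (intro closed_set_integral_zero [OF w c s]) auto
    moreover have "K n \<in> sets circ"
      using Kn P by (auto simp: sets_restrict_space_iff)
    ultimately show ?thesis
      using Kn by (intro null_if_pos_func_has_zero_int [OF w]) (auto simp: P_def)
  qed
  then have "C \<in> null_sets circ"
    using K by auto
  moreover have "T \<in> null_sets circ"
    using C P by (auto simp: null_sets_restrict_space)
  ultimately have "P \<in> null_sets circ"
    using C(3) by (metis null_sets.Un)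
  then show ?thesis
    by (rule AE_I') (auto simp: P_def)
qed

lemma AE_zero_if_fourier_zero:
  fixes w :: "real \<Rightarrow> real"
  assumes w: "integrable circ w"
    and c: "\<And>k::int. (LINT t|circ. cos (k * t) * w t) = 0"
    and s: "\<And>k::int. (LINT t|circ. sin (k * t) * w t) = 0"
  shows "AE t in circ. w t = 0"
proof -
  have "AE t in circ. w t \<le> 0"
    by (rule AE_nonpos_if_fourier_zero [OF w c s])
  moreover have "AE t in circ. - w t \<le> 0"
    using w c s by (intro AE_nonpos_if_fourier_zero) simp_all
  ultimately show ?thesis
    by eventually_elim simp
qed

subsection \<open>Weak derivatives of real functions\<close>


text \<open>Test functions must have differentiable iterated derivatives of every order. The span of
  cos(ct) and sin(ct) is invariant under differentiation, which allows an induction with changing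
  coefficients.\<close>

lemma higher_deriv_trig:
  fixes c :: real
  shows "\<exists>a' b'. (deriv ^^ n) (\<lambda>t. a * cos (c * t) + b * sin (c * t)) =
    (\<lambda>t. a' * cos (c * t) + b' * sin (c * t))"
proof (induction n)
  case (Suc n)
  then obtain a' b' where
    *: "(deriv ^^ n) (\<lambda>t. a * cos (c * t) + b * sin (c * t)) = (\<lambda>t. a' * cos (c * t) + b' * sin (c * t))"
    by blast
  have "deriv (\<lambda>t. a' * cos (c * t) + b' * sin (c * t)) = (\<lambda>t. (b' * c) * cos (c * t) + (- a' * c) * sin (c * t))"
    by (rule ext, rule DERIV_imp_deriv) (auto intro!: derivative_eq_intros)
  then show ?case
    using * by (intro exI [of _ "b' * c"] exI [of _ "- a' * c"]) simp
qed auto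

lemma torus_test_function_trig:
  "torus_test_function (\<lambda>t. a * cos (of_int k * t) + b * sin (of_int k * t))"
proof -
  have "of_int k * (t + 2 * pi) = of_int k * t + 2 * pi * of_int k" for t
    by (simp add: algebra_simps)
  then have "torus_periodic (\<lambda>t. a * cos (of_int k * t) + b * sin (of_int k * t))"
    by (simp add: torus_periodic_def sin_add cos_add)
  moreover have "(deriv ^^ n) (\<lambda>t. a * cos (of_int k * t) + b * sin (of_int k * t)) field_differentiable at s" for n s
  proof -
    obtain a' b' where eq: "(deriv ^^ n) (\<lambda>t. a * cos (of_int k * t) + b * sin (of_int k * t)) =
        (\<lambda>t. a' * cos (of_int k * t) + b' * sin (of_int k * t))"
      using higher_deriv_trig [of n a "of_int k" b] by blast
    have "((\<lambda>t. a' * cos (of_int k * t) + b' * sin (of_int k * t)) has_field_derivative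
        b' * of_int k * cos (of_int k * s) - a' * of_int k * sin (of_int k * s)) (at s)"
      by (auto intro!: derivative_eq_intros)
    then show ?thesis
      unfolding eq field_differentiable_def by blast
  qed
  ultimately show ?thesis
    by (simp add: torus_test_function_def)
qed

lemma set_integral_circ:
  fixes f :: "real \<Rightarrow> 'a::euclidean_space"
  shows "(LINT t:{0..2 * pi}|lebesgue. f t) = (LINT t|circ. f t)"
  by (simp add: set_lebesgue_integral_def integral_restrict_space)

lemma integrable_circ_iff:
  fixes f :: "real \<Rightarrow> 'a::euclidean_space"
  shows "integrable circ f \<longleftrightarrow> f absolutely_integrable_on {0..2 * pi}"
  by (simp add: set_integrable_def integrable_restrict_space)

text \<open>The period has finite measure, so square integrability gives integrability through x
  \<le> 1 + x^2.\<close>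

lemma L2_torus_integrable:
  fixes f :: "real \<Rightarrow> 'a::euclidean_space"
  assumes "f \<in> L2_torus"
  shows "integrable circ f" "integrable circ (\<lambda>t. (norm (f t))\<^sup>2)"
proof -
  show sq: "integrable circ (\<lambda>t. (norm (f t))\<^sup>2)"
    using assms by (simp add: L2_torus_def integrable_circ_iff)
  have "integrable circ (\<lambda>t. 1 + (norm (f t))\<^sup>2)"
    using sq by (intro Bochner_Integration.integrable_add) auto
  then show "integrable circ f"
  proof (rule Bochner_Integration.integrable_bound)
    show "f \<in> borel_measurable circ"
      using assms by (auto simp: L2_torus_def intro: measurable_restrict_space1)
    have "x \<le> 1 + x\<^sup>2" for x :: real
      using zero_le_power2 [of "x - 1 / 2"] by (simp add: power2_eq_square algebra_simps)
    then show "AE t in circ. norm (f t) \<le> norm (1 + (norm (f t))\<^sup>2)"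
      by (intro AE_I2) (smt (verit) real_norm_def)
  qed
qed

lemma has_weak_deriv_trig:
  fixes f g :: "real \<Rightarrow> real"
  assumes "has_weak_deriv f g"
  shows "(LINT t|circ. (of_int k * (b * cos (of_int k * t) - a * sin (of_int k * t))) * f t) =
    - (LINT t|circ. (a * cos (of_int k * t) + b * sin (of_int k * t)) * g t)"
proof -
  define \<phi> where "\<phi> t = a * cos (of_int k * t) + b * sin (of_int k * t)" for t :: real
  have "torus_test_function \<phi>"
    unfolding \<phi>_def by (rule torus_test_function_trig)
  then have "(LINT t|circ. deriv \<phi> t * f t) = - (LINT t|circ. \<phi> t * g t)"
    using assms by (simp add: has_weak_deriv_def set_integral_circ)
  moreover have "deriv \<phi> = (\<lambda>t. of_int k * (b * cos (of_int k * t) - a * sin (of_int k * t)))"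
    unfolding \<phi>_def
    by (rule ext, rule DERIV_imp_deriv) (auto intro!: derivative_eq_intros simp: algebra_simps)
  ultimately show ?thesis
    by (simp add: \<phi>_def)
qed

text \<open>Passes between the Bochner integral, used for Fubini, and the gauge integral, used for
  the fundamental theorem of calculus. Allowing any A with trace S on the period admits half-lines,
  so one kernel for s \<le> t serves both orders of integration.\<close>

lemma integral_circ_indicator:
  fixes f :: "real \<Rightarrow> real"
  assumes f: "integrable circ f" and S: "S \<in> sets lebesgue" "S \<subseteq> {0..2 * pi}"
    and A: "A \<inter> {0..2 * pi} = S"
  shows "(LINT t|circ. indicator A t * f t) = integral S f"
proof -
  have "f absolutely_integrable_on S"
    using f S by (auto simp: integrable_circ_iff intro: set_integrable_subset)
  then have "integral S f = (LINT t:S|lebesgue. f t)"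
    by (simp add: set_lebesgue_integral_eq_integral)
  also have "\<dots> = (LINT t|lebesgue. indicator {0..2 * pi} t * (indicator A t * f t))"
    unfolding set_lebesgue_integral_def using A
    by (intro Bochner_Integration.integral_cong) (auto simp: indicator_def)
  also have "\<dots> = (LINT t|circ. indicator A t * f t)"
    by (simp add: integral_restrict_space)
  finally show ?thesis
    by simp
qed

text \<open>Since g is only integrable, its indefinite integral need not be differentiable
  everywhere. Fubini on the triangle s \<le> t takes the place of the product rule: the inner
  integral of \<phi>' over [s, 2 pi] is \<phi>(2 pi) - \<phi>(s).\<close>

lemma integral_by_parts_indefinite:
  fixes g \<phi> \<phi>' :: "real \<Rightarrow> real"
  assumes g: "integrable circ g"
    and \<phi>: "\<And>t. (\<phi> has_real_derivative \<phi>' t) (at t)" "continuous_on UNIV \<phi>'"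
  shows "(LINT t|circ. \<phi>' t * integral {0..t} g) =
    \<phi> (2 * pi) * (LINT t|circ. g t) - (LINT t|circ. \<phi> t * g t)"
proof -
  interpret fin: finite_measure circ
    by (intro finite_measure_lebesgue_on) auto
  interpret pair_sigma_finite circ circ ..
  have \<phi>'c: "continuous_on {0..2 * pi} \<phi>'"
    using \<phi>(2) continuous_on_subset by blast
  then have "bounded (\<phi>' ` {0..2 * pi})"
    by (intro compact_imp_bounded compact_continuous_image) auto
  then obtain B where B: "\<And>t. t \<in> {0..2 * pi} \<Longrightarrow> \<bar>\<phi>' t\<bar> \<le> B"
    unfolding bounded_iff by (metis imageI real_norm_def)
  have B0: "B \<ge> 0"
    using B [of 0] by simp
  have \<phi>c: "continuous_on {0..2 * pi} \<phi>"
    using \<phi>(1) by (meson DERIV_isCont continuous_at_imp_continuous_on)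
  have [measurable]: "\<phi>' \<in> borel_measurable circ" "g \<in> borel_measurable circ" "(\<lambda>t. t) \<in> borel_measurable circ"
    using \<phi>'c g by (auto intro!: continuous_imp_measurable_on_sets_lebesgue continuous_on_id)
  \<comment> \<open>The kernel is dominated by B |g s|, which is integrable on the product because
    the period has finite measure.\<close>
  have dom: "integrable (circ \<Otimes>\<^sub>M circ) (\<lambda>(t, s). B * \<bar>g s\<bar>)"
    using g B0 by (intro Fubini_integrable) (auto simp: abs_mult)
  have H: "integrable (circ \<Otimes>\<^sub>M circ) (\<lambda>(t, s). \<phi>' t * (if s \<le> t then 1 else 0) * g s)"
  proof (rule Bochner_Integration.integrable_bound [OF dom])
    show "(\<lambda>(t, s). \<phi>' t * (if s \<le> t then 1 else 0) * g s) \<in> borel_measurable (circ \<Otimes>\<^sub>M circ)"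
      by measurable
    show "AE x in circ \<Otimes>\<^sub>M circ. norm (case x of (t, s) \<Rightarrow> \<phi>' t * (if s \<le> t then 1 else 0) * g s)
        \<le> norm (case x of (t, s) \<Rightarrow> B * \<bar>g s\<bar>)"
      using B B0 by (intro AE_I2) (auto simp: space_pair_measure abs_mult intro!: mult_right_mono)
  qed
  have "(LINT t|circ. \<phi>' t * integral {0..t} g) =
      (LINT t|circ. LINT s|circ. \<phi>' t * (if s \<le> t then 1 else 0) * g s)"
  proof (rule Bochner_Integration.integral_cong)
    fix t assume "t \<in> space circ"
    then have "integral {0..t} g = (LINT s|circ. indicator {..t} s * g s)"
      using g by (intro integral_circ_indicator [symmetric]) auto
    also have "\<phi>' t * \<dots> = (LINT s|circ. \<phi>' t * (indicator {..t} s * g s))"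
      by simp
    also have "\<dots> = (LINT s|circ. \<phi>' t * (if s \<le> t then 1 else 0) * g s)"
      by (intro Bochner_Integration.integral_cong) (auto simp: indicator_def)
    finally show "\<phi>' t * integral {0..t} g = (LINT s|circ. \<phi>' t * (if s \<le> t then 1 else 0) * g s)" .
  qed simp
  also have "\<dots> = (LINT s|circ. LINT t|circ. \<phi>' t * (if s \<le> t then 1 else 0) * g s)"
    by (rule Fubini_integral [OF H, symmetric])
  also have "\<dots> = (LINT s|circ. \<phi> (2 * pi) * g s - \<phi> s * g s)"
  proof (rule Bochner_Integration.integral_cong)
    fix s assume "s \<in> space circ"
    then have s: "0 \<le> s" "s \<le> 2 * pi"
      by auto
    have "integrable circ \<phi>'"
      by (rule integrable_circ_continuous [OF \<phi>'c])
    then have "(LINT t|circ. indicator {s..} t * \<phi>' t) = integral {s..2 * pi} \<phi>'"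
      using s by (intro integral_circ_indicator) auto
    also have "\<dots> = \<phi> (2 * pi) - \<phi> s"
      using s \<phi>(1)
      by (intro integral_unique fundamental_theorem_of_calculus)
        (auto simp: has_real_derivative_iff_has_vector_derivative intro: has_vector_derivative_at_within)
    finally have "(\<phi> (2 * pi) - \<phi> s) * g s = (LINT t|circ. indicator {s..} t * \<phi>' t) * g s"
      by simp
    also have "\<dots> = (LINT t|circ. (indicator {s..} t * \<phi>' t) * g s)"
      by simp
    also have "\<dots> = (LINT t|circ. \<phi>' t * (if s \<le> t then 1 else 0) * g s)"
      by (intro Bochner_Integration.integral_cong) (auto simp: indicator_def)
    finally show "(LINT t|circ. \<phi>' t * (if s \<le> t then 1 else 0) * g s) = \<phi> (2 * pi) * g s - \<phi> s * g s"
      by (simp add: left_diff_distrib)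
  qed simp
  also have "\<dots> = \<phi> (2 * pi) * (LINT t|circ. g t) - (LINT t|circ. \<phi> t * g t)"
    using g integrable_circ_continuous_scaleR [OF \<phi>c g] by simp
  finally show ?thesis .
qed

text \<open>A du Bois-Reymond argument: f and the antiderivative G of g have the same integral
  against the derivative of each trigonometric test function. Hence f - G has no nonconstant Fourier
  mode, and subtracting its mean leaves a function that is zero almost everywhere.\<close>

lemma weak_deriv_real_antiderivative:
  fixes f g :: "real \<Rightarrow> real"
  assumes fg: "has_weak_deriv f g"
  shows "\<exists>c. AE t in circ. f t = c + integral {0..t} g"
proof -
  have f: "integrable circ f" and g: "integrable circ g"
    using fg by (auto simp: has_weak_deriv_def L2_torus_integrable)
  define G where "G t = integral {0..t} g" for t
  have "g integrable_on {0..2 * pi}"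
    using g by (simp add: integrable_circ_iff set_lebesgue_integral_eq_integral)
  then have Gc: "continuous_on {0..2 * pi} G"
    unfolding G_def by (rule indefinite_integral_continuous_1)
  have G: "integrable circ G"
    by (rule integrable_circ_continuous [OF Gc])
  \<comment> \<open>Testing with the constant 1 shows that g has mean zero. This removes the
    boundary term in the integration by parts for G.\<close>
  have g0: "(LINT t|circ. g t) = 0"
    using has_weak_deriv_trig [OF fg, of 0 0 1] by simp
  \<comment> \<open>The mean of f - G over the period, so that the zeroth Fourier coefficient of w
    vanishes.\<close>
  define c where "c = (LINT t|circ. f t - G t) / (2 * pi)"
  define w where "w t = f t - G t - c" for t
  have w: "integrable circ w"
    unfolding w_def using f G by auto
  have trigw: "(LINT t|circ. (of_int k * (b * cos (of_int k * t) - a * sin (of_int k * t))) * w t) = 0"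
    for a b :: real and k :: int
  proof -
    define \<phi> where "\<phi> t = a * cos (of_int k * t) + b * sin (of_int k * t)" for t :: real
    define \<phi>' where "\<phi>' t = of_int k * (b * cos (of_int k * t) - a * sin (of_int k * t))" for t :: real
    have d: "(\<phi> has_real_derivative \<phi>' t) (at t)" for t
      unfolding \<phi>_def \<phi>'_def by (auto intro!: derivative_eq_intros simp: algebra_simps)
    have c': "continuous_on A \<phi>'" for A
      unfolding \<phi>'_def by (intro continuous_intros)
    have "(LINT t|circ. \<phi>' t * f t) = - (LINT t|circ. \<phi> t * g t)"
      unfolding \<phi>_def \<phi>'_def by (rule has_weak_deriv_trig [OF fg])
    moreover have "(LINT t|circ. \<phi>' t * G t) = - (LINT t|circ. \<phi> t * g t)"
      unfolding G_def using integral_by_parts_indefinite [OF g d c'] g0 by simp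
    moreover have "(LINT t|circ. \<phi>' t * c) = 0"
    proof -
      have "(\<phi>' has_integral (\<phi> (2 * pi) - \<phi> 0)) {0..2 * pi}"
        using d by (intro fundamental_theorem_of_calculus)
          (auto simp: has_real_derivative_iff_has_vector_derivative intro: has_vector_derivative_at_within)
      moreover have "\<phi> (2 * pi) = \<phi> 0"
      proof -
        have "torus_periodic \<phi>"
          using torus_test_function_trig [of a k b] unfolding torus_test_function_def \<phi>_def by blast
        then have "\<phi> (0 + 2 * pi) = \<phi> 0"
          unfolding torus_periodic_def by blast
        then show ?thesis
          by simp
      qed
      moreover have "integrable circ \<phi>'"
        by (rule integrable_circ_continuous [OF c'])
      then have "(LINT t|circ. \<phi>' t) = integral {0..2 * pi} \<phi>'"
        using set_lebesgue_integral_eq_integral(2) [of "{0..2 * pi}" \<phi>']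
        by (simp add: integrable_circ_iff set_integral_circ)
      ultimately show ?thesis
        by (simp add: integral_unique)
    qed
    moreover have "integrable circ (\<lambda>t. \<phi>' t * f t)" "integrable circ (\<lambda>t. \<phi>' t * G t)" "integrable circ (\<lambda>t. \<phi>' t * c)"
      using integrable_circ_continuous_scaleR [OF c' f] integrable_circ_continuous_scaleR [OF c' G]
        integrable_circ_continuous_scaleR [OF c', of "\<lambda>_. c"] by auto
    ultimately have "(LINT t|circ. \<phi>' t * w t) = 0"
      by (simp add: w_def right_diff_distrib)
    then show ?thesis
      by (simp add: \<phi>'_def)
  qed
  have w0: "(LINT t|circ. w t) = 0"
    using f G by (simp add: w_def c_def measure_restrict_space)
  have "AE t in circ. w t = 0"
  proof (rule AE_zero_if_fourier_zero [OF w])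
    \<comment> \<open>For nonzero k, the functions k cos(kt) and k sin(kt) are the derivatives of
      sin(kt) and - cos(kt), so the factor k can be cancelled. The frequency k = 0 is covered by the
      mean of w.\<close>
    fix k :: int
    show "(LINT t|circ. cos (k * t) * w t) = 0"
      using trigw [of k 1 0] w0 by (cases "k = 0") (simp_all add: mult.assoc)
    show "(LINT t|circ. sin (k * t) * w t) = 0"
      using trigw [of k 0 "-1"] w0 by (cases "k = 0") (simp_all add: mult.assoc)
  qed
  then have "AE t in circ. f t = c + integral {0..t} g"
    by (simp add: w_def G_def algebra_simps)
  then show ?thesis ..
qed

text \<open>Both candidates have the same integral against every cos(kt) and sin(kt), so their
  difference has zero Fourier coefficients. This ties the chosen \<open>weak_deriv\<close> to the
  witnesses in the definition of H^2.\<close>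

lemma weak_deriv_real_unique:
  fixes f g h :: "real \<Rightarrow> real"
  assumes "has_weak_deriv f g" "has_weak_deriv f h"
  shows "AE t in circ. g t = h t"
proof -
  have g: "integrable circ g" and h: "integrable circ h"
    using assms by (auto simp: has_weak_deriv_def L2_torus_integrable)
  have *: "(LINT t|circ. (a * cos (of_int k * t) + b * sin (of_int k * t)) * (g t - h t)) = 0" for a b and k :: int
  proof -
    have c: "continuous_on A (\<lambda>t. a * cos (of_int k * t) + b * sin (of_int k * t))" for A
      by (intro continuous_intros)
    show ?thesis
      using has_weak_deriv_trig [OF assms(1), of k b a] has_weak_deriv_trig [OF assms(2), of k b a]
        integrable_circ_continuous_scaleR [OF c g] integrable_circ_continuous_scaleR [OF c h]
      by (simp add: right_diff_distrib)
  qed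
  have "AE t in circ. g t - h t = 0"
    using * [of 1 _ 0] * [of 0 _ 1] g h by (intro AE_zero_if_fourier_zero) auto
  then show ?thesis
    by simp
qed

subsection \<open>Vector-valued functions and the Sobolev embedding\<close>


lemma torus_test_function_continuous:
  assumes "torus_test_function \<phi>"
  shows "continuous_on A \<phi>" "continuous_on A (deriv \<phi>)"
proof -
  have d: "(deriv ^^ n) \<phi> field_differentiable at t" for n t
    using assms by (simp add: torus_test_function_def)
  show "continuous_on A \<phi>" "continuous_on A (deriv \<phi>)"
    using d [of 0] d [of 1]
    by (auto intro!: continuous_at_imp_continuous_on field_differentiable_imp_continuous_at)
qed

lemma L2_torus_inner:
  assumes "f \<in> L2_torus"
  shows "(\<lambda>t. f t \<bullet> b) \<in> L2_torus"
proof -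
  have m: "f \<in> borel_measurable lebesgue"
    using assms by (simp add: L2_torus_def)
  have "integrable circ (\<lambda>t. (norm b)\<^sup>2 * (norm (f t))\<^sup>2)"
    using L2_torus_integrable(2) [OF assms] by simp
  then have "integrable circ (\<lambda>t. (norm (f t \<bullet> b))\<^sup>2)"
  proof (rule Bochner_Integration.integrable_bound)
    show "(\<lambda>t. (norm (f t \<bullet> b))\<^sup>2) \<in> borel_measurable circ"
      by (intro measurable_restrict_space1 borel_measurable_power
          measurable_compose [OF _ borel_measurable_norm] borel_measurable_inner borel_measurable_const m)
    have "(f t \<bullet> b)\<^sup>2 \<le> (norm b)\<^sup>2 * (norm (f t))\<^sup>2" for t
      using power_mono [OF Cauchy_Schwarz_ineq2 [of "f t" b], of 2] by (simp add: power_mult_distrib mult.commute)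
    then show "AE t in circ. norm ((norm (f t \<bullet> b))\<^sup>2) \<le> norm ((norm b)\<^sup>2 * (norm (f t))\<^sup>2)"
      by (intro AE_I2) simp
  qed
  moreover have "(\<lambda>t. f t \<bullet> b) \<in> borel_measurable lebesgue"
    by (intro borel_measurable_inner borel_measurable_const m)
  ultimately show ?thesis
    using assms by (simp add: L2_torus_def integrable_circ_iff torus_periodic_def)
qed

text \<open>Reduces vector-valued statements to real ones, one basis vector at a time; only finitely
  many exceptional null sets then have to be joined.\<close>

lemma has_weak_deriv_inner:
  assumes "has_weak_deriv f g"
  shows "has_weak_deriv (\<lambda>t. f t \<bullet> b) (\<lambda>t. g t \<bullet> b)"
  unfolding has_weak_deriv_def
proof (intro conjI allI impI)
  have f: "f \<in> L2_torus" and g: "g \<in> L2_torus"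
    using assms by (auto simp: has_weak_deriv_def)
  then show "(\<lambda>t. f t \<bullet> b) \<in> L2_torus" "(\<lambda>t. g t \<bullet> b) \<in> L2_torus"
    by (auto intro: L2_torus_inner)
  fix \<phi> assume \<phi>: "torus_test_function \<phi>"
  have "integrable circ (\<lambda>t. deriv \<phi> t *\<^sub>R f t)" "integrable circ (\<lambda>t. \<phi> t *\<^sub>R g t)"
    using L2_torus_integrable(1) [OF f] L2_torus_integrable(1) [OF g] torus_test_function_continuous [OF \<phi>]
    by (auto intro: integrable_circ_continuous_scaleR)
  then have "(LINT t|circ. deriv \<phi> t *\<^sub>R f t) \<bullet> b = (LINT t|circ. deriv \<phi> t *\<^sub>R (f t \<bullet> b))"
    "(LINT t|circ. \<phi> t *\<^sub>R g t) \<bullet> b = (LINT t|circ. \<phi> t *\<^sub>R (g t \<bullet> b))"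
    by (simp_all flip: integral_inner_left)
  moreover have "(LINT t|circ. deriv \<phi> t *\<^sub>R f t) = - (LINT t|circ. \<phi> t *\<^sub>R g t)"
    using assms \<phi> by (simp add: has_weak_deriv_def set_integral_circ)
  ultimately show "(LINT t:{0..2 * pi}|lebesgue. deriv \<phi> t *\<^sub>R (f t \<bullet> b)) =
      - (LINT t:{0..2 * pi}|lebesgue. \<phi> t *\<^sub>R (g t \<bullet> b))"
    unfolding set_integral_circ by (metis inner_minus_left)
qed

lemma weak_deriv_antiderivative:
  assumes "has_weak_deriv f g"
  shows "\<exists>c. AE t in circ. f t = c + integral {0..t} g"
proof -
  have "\<forall>b. \<exists>c. AE t in circ. f t \<bullet> b = c + integral {0..t} (\<lambda>t. g t \<bullet> b)"
    using weak_deriv_real_antiderivative [OF has_weak_deriv_inner [OF assms]] by blast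
  then obtain c where c: "\<And>b. AE t in circ. f t \<bullet> b = c b + integral {0..t} (\<lambda>t. g t \<bullet> b)"
    by metis
  define d where "d = (\<Sum>b\<in>Basis. c b *\<^sub>R b)"
  have "g \<in> L2_torus"
    using assms by (simp add: has_weak_deriv_def)
  then have "g integrable_on {0..2 * pi}"
    using L2_torus_integrable(1) integrable_circ_iff set_lebesgue_integral_eq_integral(1) by blast
  then have g: "g integrable_on {0..t}" if "t \<in> space circ" for t
    using that by (auto intro: integrable_on_subinterval)
  have "AE t in circ. \<forall>b\<in>Basis. f t \<bullet> b = c b + integral {0..t} (\<lambda>t. g t \<bullet> b)"
    using c by (intro AE_finite_allI) auto
  with AE_space have "AE t in circ. f t = d + integral {0..t} g"
  proof eventually_elim
    case (elim t)
    show ?case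
    proof (rule euclidean_eqI)
      fix b :: 'a assume b: "b \<in> Basis"
      then have "d \<bullet> b = c b"
        by (simp add: d_def)
      then show "f t \<bullet> b = (d + integral {0..t} g) \<bullet> b"
        using elim b g [OF elim(1)] by (simp add: inner_add_left integral_component_eq)
    qed
  qed
  then show ?thesis ..
qed

lemma weak_deriv_unique:
  assumes "has_weak_deriv f g" "has_weak_deriv f h"
  shows "AE t in circ. g t = h t"
proof -
  have "AE t in circ. \<forall>b\<in>Basis. g t \<bullet> b = h t \<bullet> b"
    using weak_deriv_real_unique [OF has_weak_deriv_inner [OF assms(1)] has_weak_deriv_inner [OF assms(2)]]
    by (intro AE_finite_allI) auto
  then show ?thesis
    by eventually_elim (auto intro: euclidean_eqI)
qed

lemma integral_cong_AE_circ:
  fixes g h :: "real \<Rightarrow> 'a::euclidean_space"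
  assumes "AE t in circ. g t = h t" "A \<subseteq> {0..2 * pi}"
  shows "integral A g = integral A h"
proof -
  have "AE t in lebesgue. t \<in> {0..2 * pi} \<longrightarrow> g t = h t"
    using assms(1) by (subst (asm) AE_restrict_space_iff) simp_all
  then have "negligible {t. \<not> (t \<in> {0..2 * pi} \<longrightarrow> g t = h t)}"
    by (simp add: completion.AE_iff_null_sets negligible_iff_null_sets)
  then show ?thesis
    using assms(2) by (intro integral_spike) auto
qed

text \<open>Integrating twice: the second weak derivative gives a continuous version G of the first,
  and by uniqueness G also represents the chosen \<open>weak_deriv u\<close>. Integrals ignore null
  sets, so G may replace \<open>weak_deriv u\<close> in the antiderivative formula for u.\<close>

lemma H2_torus_C1_representative:
  fixes u :: "real \<Rightarrow> 'a::euclidean_space"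
  assumes "u \<in> H2_torus"
  obtains F G c where "has_weak_deriv u (weak_deriv u)"
    "AE t in circ. u t = F t" "AE t in circ. weak_deriv u t = G t"
    "\<forall>t. F t = c + integral {0..t} G" "continuous_on {0..2 * pi} G"
proof -
  obtain g h where gh: "has_weak_deriv u g" "has_weak_deriv g h"
    using assms by (auto simp: H2_torus_def)
  have w: "has_weak_deriv u (weak_deriv u)"
    unfolding weak_deriv_def by (rule someI [of "has_weak_deriv u", OF gh(1)])
  obtain d where d: "AE t in circ. g t = d + integral {0..t} h"
    using weak_deriv_antiderivative [OF gh(2)] by blast
  define G where "G t = d + integral {0..t} h" for t
  have "integrable circ h"
    using gh(2) by (auto simp: has_weak_deriv_def L2_torus_integrable)
  then have "h integrable_on {0..2 * pi}"
    by (simp add: integrable_circ_iff set_lebesgue_integral_eq_integral)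
  then have G: "continuous_on {0..2 * pi} G"
    unfolding G_def by (intro continuous_intros indefinite_integral_continuous_1)
  have wG: "AE t in circ. weak_deriv u t = G t"
    using weak_deriv_unique [OF w gh(1)] d by eventually_elim (simp add: G_def)
  obtain c where c: "AE t in circ. u t = c + integral {0..t} (weak_deriv u)"
    using weak_deriv_antiderivative [OF w] by blast
  define F where "F t = c + integral {0..t} G" for t
  have "AE t in circ. u t = F t"
    using AE_space c
  proof eventually_elim
    case (elim t)
    then show ?case
      using integral_cong_AE_circ [OF wG, of "{0..t}"] by (simp add: F_def)
  qed
  then show ?thesis
    using that [OF w _ wG _ G] F_def by blast
qed

lemma norm_diff_antiderivative_le:
  fixes G :: "real \<Rightarrow> 'a::euclidean_space"
  assumes "continuous_on {0..2 * pi} G" "s \<in> {0..2 * pi}" "t \<in> {0..2 * pi}"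
  shows "norm (integral {0..t} G - integral {0..s} G) \<le> integral {0..2 * pi} (\<lambda>r. norm (G r))"
proof -
  have *: "norm (integral {0..t} G - integral {0..s} G) \<le> integral {0..2 * pi} (\<lambda>r. norm (G r))"
    if st: "0 \<le> s" "s \<le> t" "t \<le> 2 * pi" for s t
  proof -
    have i: "G integrable_on {a..b}" "(\<lambda>r. norm (G r)) integrable_on {a..b}" if "0 \<le> a" "b \<le> 2 * pi" for a b
      using that assms(1)
      by (auto intro!: integrable_continuous_real continuous_on_norm intro: continuous_on_subset)
    have "integral {0..t} G - integral {0..s} G = integral {s..t} G"
      using Henstock_Kurzweil_Integration.integral_combine [of 0 s t G] i st by (simp add: algebra_simps)
    moreover have "norm (integral {s..t} G) \<le> integral {s..t} (\<lambda>r. norm (G r))"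
      using i st by (intro integral_norm_bound_integral) auto
    moreover have "\<dots> \<le> integral {0..2 * pi} (\<lambda>r. norm (G r))"
      using i st by (intro integral_subset_le) auto
    ultimately show ?thesis
      by simp
  qed
  show ?thesis
    using *[of s t] *[of t s] assms(2,3) by (cases "s \<le> t") (auto simp: norm_minus_commute)
qed

lemma H2_norm_bounds:
  fixes u :: "real \<Rightarrow> 'a::euclidean_space"
  assumes "H2_norm u < \<delta>"
  shows "(LINT t|circ. (norm (u t))\<^sup>2) < \<delta>\<^sup>2" "(LINT t|circ. (norm (weak_deriv u t))\<^sup>2) < \<delta>\<^sup>2"
proof -
  have nn: "(LINT t|circ. (norm (v t))\<^sup>2) \<ge> 0" for v :: "real \<Rightarrow> 'a"
    by simp
  \<comment> \<open>A norm is nonnegative, so \<delta> is positive and equals the square root of its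
    square.\<close>
  have "\<bar>\<delta>\<bar> = \<delta>"
    using assms order.strict_trans1 [OF _ assms, of 0] nn
    by (simp add: H2_norm_def set_integral_circ add_nonneg_nonneg)
  then have "sqrt ((LINT t|circ. (norm (u t))\<^sup>2) + (LINT t|circ. (norm (weak_deriv u t))\<^sup>2) +
      (LINT t|circ. (norm (weak_deriv (weak_deriv u) t))\<^sup>2)) < sqrt (\<delta>\<^sup>2)"
    using assms by (simp add: H2_norm_def set_integral_circ)
  then show "(LINT t|circ. (norm (u t))\<^sup>2) < \<delta>\<^sup>2" "(LINT t|circ. (norm (weak_deriv u t))\<^sup>2) < \<delta>\<^sup>2"
    unfolding real_sqrt_less_iff
    using nn [of u] nn [of "weak_deriv u"] nn [of "weak_deriv (weak_deriv u)"] by linarith+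
qed

text \<open>The oscillation of F is at most the L^1 norm of its derivative, here at most R/2. If |F|
  reached R somewhere, it would be at least R/2 on the whole period, and the squared L^2 norm at
  least pi R^2 / 2, which exceeds R^2 / 36.\<close>

lemma Sobolev_bound:
  fixes u :: "real \<Rightarrow> 'a::euclidean_space"
  assumes u: "u \<in> H2_torus" "H2_norm u < R / 6" and R: "R > 0"
  shows "AE t in circ. norm (u t) < R"
proof -
  obtain F G c where w: "has_weak_deriv u (weak_deriv u)"
    and uF: "AE t in circ. u t = F t" and wG: "AE t in circ. weak_deriv u t = G t"
    and F: "\<forall>t. F t = c + integral {0..t} G" and G: "continuous_on {0..2 * pi} G"
    by (rule H2_torus_C1_representative [OF u(1)]) blast
  have L2: "u \<in> L2_torus" "weak_deriv u \<in> L2_torus"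
    using w by (auto simp: has_weak_deriv_def)
  define g where "g = weak_deriv u"
  have g: "integrable circ (\<lambda>t. norm (g t))" "integrable circ (\<lambda>t. (norm (g t))\<^sup>2)"
    using L2_torus_integrable [OF L2(2)] by (auto simp: g_def)
  \<comment> \<open>Weight for the inequality |g| \<le> a/2 + |g|^2 / (2a), which passes from L^2 to
    L^1. Integrated, it gives pi a = R/4 plus at most pi R / 18, and the total is at most R/2
    because pi < 4.\<close>
  define a where "a = R / (4 * pi)"
  have a: "a > 0"
    using R by (simp add: a_def)
  have "integral {0..2 * pi} (\<lambda>r. norm (G r)) = integral {0..2 * pi} (\<lambda>r. norm (g r))"
    using wG by (intro integral_cong_AE_circ) (auto simp: g_def)
  also have "\<dots> = (LINT r|circ. norm (g r))"
    using g(1) set_lebesgue_integral_eq_integral(2) [of "{0..2 * pi}" "\<lambda>r. norm (g r)"]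
    by (simp add: integrable_circ_iff set_integral_circ)
  also have "\<dots> \<le> (LINT r|circ. a / 2 + (norm (g r))\<^sup>2 / (2 * a))"
  proof (rule integral_mono)
    show "integrable circ (\<lambda>r. a / 2 + (norm (g r))\<^sup>2 / (2 * a))"
      using g by (intro Bochner_Integration.integrable_add) auto
    show "norm (g r) \<le> a / 2 + (norm (g r))\<^sup>2 / (2 * a)" for r
      using a zero_le_power2 [of "a - norm (g r)"] by (simp add: field_simps power2_eq_square)
  qed (rule g)
  also have "\<dots> = pi * a + (LINT r|circ. (norm (g r))\<^sup>2) / (2 * a)"
    using g(2) by (simp add: measure_restrict_space)
  also have "\<dots> \<le> pi * a + (R / 6)\<^sup>2 / (2 * a)"
    using H2_norm_bounds(2) [OF u(2)] a by (intro add_left_mono divide_right_mono) (auto simp: g_def)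
  also have "\<dots> = R / 4 + pi * R / 18"
    using R by (simp add: a_def power2_eq_square field_simps)
  also have "\<dots> \<le> R / 2"
    using mult_right_mono [of pi 4 R] pi_less_4 R by (simp add: field_simps)
  finally have osc: "integral {0..2 * pi} (\<lambda>r. norm (G r)) \<le> R / 2" .
  have FR: "norm (F t) < R" if t: "t \<in> {0..2 * pi}" for t
  proof (rule ccontr)
    assume "\<not> norm (F t) < R"
    then have far: "R / 2 \<le> norm (F s)" if "s \<in> {0..2 * pi}" for s
      using norm_diff_antiderivative_le [OF G that t] osc norm_triangle_ineq2 [of "F t" "F s"] by (simp add: F)
    have "(LINT s|circ. (R / 2)\<^sup>2) \<le> (LINT s|circ. (norm (u s))\<^sup>2)"
    proof (rule integral_mono_AE)
      show "AE s in circ. (R / 2)\<^sup>2 \<le> (norm (u s))\<^sup>2"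
        using AE_space uF
      proof eventually_elim
        case (elim s)
        then show ?case
          using R far [of s] by (intro power_mono) auto
      qed
    qed (use L2_torus_integrable [OF L2(1)] in auto)
    also have "\<dots> < (R / 6)\<^sup>2"
      by (rule H2_norm_bounds [OF u(2)])
    finally have "2 * pi * (R / 2)\<^sup>2 < (R / 6)\<^sup>2"
      by (simp add: measure_restrict_space)
    then have "18 * pi * R\<^sup>2 < 1 * R\<^sup>2"
      by (simp add: power2_eq_square field_simps)
    then show False
      using R pi_gt3 by (simp only: mult_less_cancel_right) (auto simp: zero_less_power2)
  qed
  show ?thesis
    using AE_space uF
  proof eventually_elim
    case (elim t)
    then show ?case
      using FR [of t] by simp
  qed
qed

subsection \<open>Tangential and full operator\<close>


text \<open>Writes a coordinate vector as scalar functions times constant vectors, a form to which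
  the derivative rules apply.\<close>

lemma vector_3_eq_axis:
  "(vector [a, b, c] :: real^3) = a *\<^sub>R axis 1 1 + b *\<^sub>R axis 2 1 + c *\<^sub>R axis 3 1"
  by (simp add: vec_eq_iff forall_3 axis_def)

lemma has_vector_derivative_x0: "(x0 R has_vector_derivative R *\<^sub>R E2 t) (at t)"
proof -
  have "x0 R = (\<lambda>s. (R * cos s) *\<^sub>R axis 1 1 + (R * sin s) *\<^sub>R axis 2 1)"
    by (simp add: fun_eq_iff x0_def vector_3_eq_axis)
  moreover have "R *\<^sub>R E2 t = (- R * sin t) *\<^sub>R axis 1 1 + (R * cos t) *\<^sub>R axis 2 1"
    by (simp add: E2_def vector_3_eq_axis scaleR_diff_right)
  moreover have "((\<lambda>s. (R * cos s) *\<^sub>R axis 1 1 + (R * sin s) *\<^sub>R axis 2 1 :: real^3)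
      has_vector_derivative (- R * sin t) *\<^sub>R axis 1 1 + (R * cos t) *\<^sub>R axis 2 1) (at t)"
    by (auto intro!: derivative_eq_intros simp: mult.commute)
  ultimately show ?thesis
    by simp
qed

lemma x0''_eq: "x0'' R t = - x0 R t"
proof -
  have "(\<lambda>s. vector_derivative (x0 R) (at s)) = (\<lambda>s. (- R * sin s) *\<^sub>R axis 1 1 + (R * cos s) *\<^sub>R axis 2 1)"
    by (rule ext, subst vector_derivative_at [OF has_vector_derivative_x0])
      (simp add: E2_def vector_3_eq_axis scaleR_diff_right)
  moreover have "((\<lambda>s. (- R * sin s) *\<^sub>R axis 1 1 + (R * cos s) *\<^sub>R axis 2 1 :: real^3)
      has_vector_derivative - x0 R t) (at t)"
    by (auto intro!: derivative_eq_intros simp: x0_def vector_3_eq_axis mult.commute)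
  ultimately show ?thesis
    by (simp add: x0''_def vector_derivative_at)
qed

text \<open>The terms of \<open>\<F>\<close> assemble to \<open>x \<times> x'' - \<lambda> e\<^sub>3 \<times> x + \<lambda> x'\<close> with \<open>x = x\<^sub>0 + u\<close>, so that only \<open>\<lambda> x \<bullet> x'\<close>
  survives in the inner product with \<open>x\<close>.\<close>

lemma F_op_inner:
  "F_op R lam u t \<bullet> (x0 R t + u t) =
    lam * (R *\<^sub>R E2 t \<bullet> u t + x0 R t \<bullet> weak_deriv u t + u t \<bullet> weak_deriv u t)"
  unfolding F_op_def x0''_eq
  by (simp add: x0_def E2_def E3_def cross3_def inner_vec_def sum_3 algebra_simps)

lemma zero_if_components_zero:
  assumes v: "v \<bullet> E2 t = 0" "v \<bullet> E3 = 0" "v \<bullet> (x0 R t + w) = 0" and w: "norm w < R"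
  shows "v = 0"
proof -
  define e :: "real^3" where "e = vector [cos t, sin t, 0]"
  have "norm e = 1"
    by (simp add: e_def norm_eq_sqrt_inner inner_vec_def sum_3 flip: power2_eq_square)
  then have "\<bar>w \<bullet> e\<bar> < R"
    using Cauchy_Schwarz_ineq2 [of w e] w by simp
  define f where "f = v \<bullet> e"
  have v1: "v $ 1 * sin t = v $ 2 * cos t" and v3: "v $ 3 = 0"
    using v(1,2) by (simp_all add: E2_def E3_def inner_vec_def sum_3)
  have f: "f = v $ 1 * cos t + v $ 2 * sin t"
    by (simp add: f_def e_def inner_vec_def sum_3)
  \<comment> \<open>Orthogonality to \<open>E2 t\<close> exchanges v1 sin t and v2 cos t, which
    collects the factor cos^2 + sin^2 = 1 and shows that the horizontal part of v is radial.\<close>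
  have "f * cos t = v $ 1 * ((cos t)\<^sup>2 + (sin t)\<^sup>2)" "f * sin t = v $ 2 * ((cos t)\<^sup>2 + (sin t)\<^sup>2)"
    using v1 unfolding f by algebra+
  then have vf: "v = f *\<^sub>R e"
    using v3 by (simp add: vec_eq_iff forall_3 e_def)
  have "e \<bullet> (x0 R t + w) = R + w \<bullet> e"
  proof -
    have "x0 R t = R *\<^sub>R e"
      by (simp add: vec_eq_iff forall_3 x0_def e_def)
    then show ?thesis
      using \<open>norm e = 1\<close> by (simp add: inner_add_right inner_commute flip: power2_norm_eq_inner)
  qed
  then have "f * (R + w \<bullet> e) = 0"
    using v(3) vf by (metis inner_scaleR_left)
  then show ?thesis
    using \<open>\<bar>w \<bullet> e\<bar> < R\<close> vf by auto
qed

text \<open>The expression is the derivative of C(u). Built from the representative, C becomes a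
  continuous function f that vanishes almost everywhere, hence everywhere inside the period; so does
  its classical derivative, which agrees with the expression almost everywhere.\<close>

lemma constraint_derivative_zero:
  assumes u: "u \<in> H2_torus" and C: "ae_zero (C_op R u)"
  shows "AE t in circ. R *\<^sub>R E2 t \<bullet> u t + x0 R t \<bullet> weak_deriv u t + u t \<bullet> weak_deriv u t = 0"
proof -
  obtain F G c where uF: "AE t in circ. u t = F t" and wG: "AE t in circ. weak_deriv u t = G t"
    and F: "\<forall>t. F t = c + integral {0..t} G" and G: "continuous_on {0..2 * pi} G"
    by (rule H2_torus_C1_representative [OF u(1)]) blast
  define f where "f t = x0 R t \<bullet> F t + 1 / 2 * (F t \<bullet> F t)" for t
  \<comment> \<open>Integration yields only one-sided derivatives at the ends of the period, hence
    the open interval.\<close>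
  have F': "(F has_vector_derivative G t) (at t)" if "t \<in> {0<..<2 * pi}" for t
  proof -
    have "((\<lambda>t. c + integral {0..t} G) has_vector_derivative 0 + G t) (at t within {0..2 * pi})"
      using G that by (intro has_vector_derivative_add integral_has_vector_derivative) auto
    moreover have "F = (\<lambda>t. c + integral {0..t} G)"
      using F by auto
    ultimately show ?thesis
      using that by (simp add: at_within_Icc_at)
  qed
  have f': "(f has_real_derivative R *\<^sub>R E2 t \<bullet> F t + x0 R t \<bullet> G t + F t \<bullet> G t) (at t)"
    if "t \<in> {0<..<2 * pi}" for t
    unfolding f_def has_real_derivative_iff_has_vector_derivative
    by (rule derivative_eq_intros has_vector_derivative_x0 F' [OF that] bounded_bilinear.has_vector_derivative [OF bounded_bilinear_inner] refl)+
      (simp add: inner_commute)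
  have f0: "f t = 0" if t: "t \<in> {0<..<2 * pi}" for t
  proof -
    have "continuous_on {0..2 * pi} F"
      using F G by (subst continuous_on_cong [OF refl, of _ _ "\<lambda>t. c + integral {0..t} G"])
        (auto intro!: continuous_intros indefinite_integral_continuous_1 integrable_continuous_real)
    moreover have "continuous_on {0..2 * pi} (x0 R)"
      using has_vector_derivative_x0 has_vector_derivative_continuous
      by (blast intro: continuous_at_imp_continuous_on)
    ultimately have "continuous_on {0..2 * pi} f"
      unfolding f_def by (intro continuous_intros)
    \<comment> \<open>A closed set that contains almost every point of an open interval contains all
      of it; this turns the almost-everywhere constraint into a pointwise one.\<close>
    then have "closed {t \<in> {0..2 * pi}. f t = 0}"
      by (intro continuous_closed_preimage_constant) auto
    moreover have "AE t in circ. f t = 0"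
    proof -
      have "AE t in circ. C_op R u t = 0"
        using C unfolding ae_zero_def by (subst AE_restrict_space_iff) (auto elim: eventually_mono)
      then show ?thesis
        using uF by eventually_elim (simp add: f_def C_op_def power2_norm_eq_inner)
    qed
    then have "AE t in lebesgue. t \<in> {0..2 * pi} \<longrightarrow> f t = 0"
      by (subst (asm) AE_restrict_space_iff) simp_all
    then have "AE t\<in>{0<..<2 * pi} in lebesgue. t \<in> {t \<in> {0..2 * pi}. f t = 0}"
      by eventually_elim auto
    ultimately have "t \<in> {t \<in> {0..2 * pi}. f t = 0}"
      using t mem_closed_if_AE_lebesgue_open [of "{0<..<2 * pi}" "{t \<in> {0..2 * pi}. f t = 0}" t] by simp
    then show ?thesis
      by simp
  qed
  have zero: "R *\<^sub>R E2 t \<bullet> F t + x0 R t \<bullet> G t + F t \<bullet> G t = 0" if t: "t \<in> {0<..<2 * pi}" for t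
  proof -
    have "((\<lambda>_. 0) has_real_derivative R *\<^sub>R E2 t \<bullet> F t + x0 R t \<bullet> G t + F t \<bullet> G t) (at t)"
      by (rule has_field_derivative_transform_within_open [OF f' [OF t], of "{0<..<2 * pi}"])
        (use t f0 in auto)
    then show ?thesis
      using DERIV_const DERIV_unique by blast
  qed
  show ?thesis
    using AE_circ_interior uF wG
  proof eventually_elim
    case (elim t)
    then show ?case
      using zero [of t] by simp
  qed
qed

text \<open>The exceptional set on the line is covered by countably many translates of the
  exceptional set of one period.\<close>

lemma AE_periodic:
  assumes circ: "AE t in circ. P t" and per: "\<And>t. P (t + 2 * pi) = P t"
  shows "AE t in lebesgue. P t"
proof -
  define N where "N = {t. \<not> (t \<in> {0..2 * pi} \<longrightarrow> P t)}"
  have "AE t in lebesgue. t \<in> {0..2 * pi} \<longrightarrow> P t"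
    using circ by (subst (asm) AE_restrict_space_iff) simp_all
  then have N: "negligible N"
    by (simp add: N_def completion.AE_iff_null_sets negligible_iff_null_sets)
  have per_nat: "P (t + 2 * pi * real n) = P t" for t n
  proof (induction n)
    case (Suc n)
    then show ?case
      using per [of "t + 2 * pi * real n"] by (simp add: algebra_simps)
  qed simp
  \<comment> \<open>For negative k the forward shift is applied at t + 2 pi k and leads back to
    t.\<close>
  have per_int: "P (t + 2 * pi * of_int k) = P t" for t k
    using per_nat [of t "nat k"] per_nat [of "t + 2 * pi * of_int k" "nat (- k)"]
    by (cases "k \<ge> 0") simp_all
  have "{t. \<not> P t} \<subseteq> (\<Union>k::int. (+) (2 * pi * of_int k) ` N)"
  proof
    fix t assume t: "t \<in> {t. \<not> P t}"
    define k where "k = \<lfloor>t / (2 * pi)\<rfloor>"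
    define s where "s = t - 2 * pi * of_int k"
    have "of_int k \<le> t / (2 * pi)" "t / (2 * pi) \<le> of_int k + 1"
      unfolding k_def by linarith+
    then have "s \<in> {0..2 * pi}"
      by (simp add: s_def field_simps)
    moreover have "P s = P t"
      using per_int [of s k] by (simp add: s_def)
    ultimately have "s \<in> N"
      using t by (simp add: N_def)
    moreover have "t = 2 * pi * of_int k + s"
      by (simp add: s_def)
    ultimately show "t \<in> (\<Union>k::int. (+) (2 * pi * of_int k) ` N)"
      by blast
  qed
  moreover have "negligible (\<Union>k::int. (+) (2 * pi * of_int k) ` N)"
    using N by (intro negligible_countable_Union) (auto intro: negligible_translation)
  ultimately have "negligible {t. \<not> P t}"
    by (rule negligible_subset [rotated])
  then show ?thesis
    by (simp add: completion.AE_iff_null_sets negligible_iff_null_sets)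
qed

theorem lemma3p4:
  fixes R :: real
  assumes "R > 0"
  shows "\<exists>U :: (real \<Rightarrow> real^3) set. H2_nhd_zero U \<and>
           (\<forall>lam::real. \<forall>u. lam > 0 \<and> u \<in> U \<longrightarrow>
              (triple_zero (G_hat R lam u) \<longleftrightarrow> pair_zero (G_op R lam u)))"
proof -
  \<comment> \<open>The ball on which |u| < R holds almost everywhere. It is fixed before \<lambda>
    is chosen, so one neighbourhood serves all \<lambda>.\<close>
  define U where "U = {u :: real \<Rightarrow> real^3. u \<in> H2_torus \<and> H2_norm u < R / 6}"
  have "H2_nhd_zero U"
    unfolding H2_nhd_zero_def U_def using assms by (intro conjI exI [of _ "R / 6"]) auto
  moreover have "triple_zero (G_hat R lam u) \<longleftrightarrow> pair_zero (G_op R lam u)" if "u \<in> U" for lam u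
  proof
    assume "pair_zero (G_op R lam u)"
    then have F: "AE t in lebesgue. F_op R lam u t = 0" and C: "ae_zero (C_op R u)"
      by (simp_all add: pair_zero_def G_op_def ae_zero_def)
    have "ae_zero (\<lambda>t. F_op R lam u t \<bullet> E2 t)" "ae_zero (\<lambda>t. F_op R lam u t \<bullet> E3)"
      unfolding ae_zero_def by (rule eventually_mono [OF F], simp)+
    with C show "triple_zero (G_hat R lam u)"
      by (simp add: triple_zero_def G_hat_def)
  next
    assume "triple_zero (G_hat R lam u)"
    then have F2: "AE t in lebesgue. F_op R lam u t \<bullet> E2 t = 0"
      and F3: "AE t in lebesgue. F_op R lam u t \<bullet> E3 = 0" and C: "ae_zero (C_op R u)"
      by (simp_all add: triple_zero_def G_hat_def ae_zero_def)
    have u: "u \<in> H2_torus" "H2_norm u < R / 6"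
      using that by (auto simp: U_def)
    \<comment> \<open>Since u lies in H^2, the choice behind \<open>weak_deriv u\<close> yields a
      genuine weak derivative; its membership in \<open>L2_torus\<close> then provides the
      periodicity.\<close>
    have "has_weak_deriv u (weak_deriv u)"
      by (rule H2_torus_C1_representative [OF u(1)])
    then have per: "u (t + 2 * pi) = u t" "weak_deriv u (t + 2 * pi) = weak_deriv u t" for t
      by (auto simp: has_weak_deriv_def L2_torus_def torus_periodic_def)
    have per0: "x0 R (t + 2 * pi) = x0 R t" "E2 (t + 2 * pi) = E2 t" for t
      by (simp_all add: x0_def E2_def)
    have "AE t in lebesgue. norm (u t) < R"
      using Sobolev_bound [OF u assms] by (rule AE_periodic) (simp add: per)
    moreover have "AE t in lebesgue. R *\<^sub>R E2 t \<bullet> u t + x0 R t \<bullet> weak_deriv u t + u t \<bullet> weak_deriv u t = 0"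
      using constraint_derivative_zero [OF u(1) C] by (rule AE_periodic) (simp add: per per0)
    ultimately have "AE t in lebesgue. F_op R lam u t = 0"
      using F2 F3
    proof eventually_elim
      case (elim t)
      then show ?case
        using F_op_inner [of R lam u t] by (intro zero_if_components_zero) auto
    qed
    with C show "pair_zero (G_op R lam u)"
      by (simp add: pair_zero_def G_op_def ae_zero_def)
  qed
  ultimately show ?thesis
    by blast
qed

end
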